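(* For $\alpha\in\mathbb Z^2$ let $\mathcal L(\alpha)$ denote the complex vector space of Laurent polynomials in the variables $x_j$, $j\in\Lambda$, that solve the $\mathcal A$-hypergeometric system with exponent $\alpha$. Then $\dim\mathcal L(\alpha)\le 2$. Moreover, $\dim\mathcal L(\alpha)\ge1$ if and only if $\alpha\in I(\mathcal A)\cup E_0(\mathcal A)\cup E_d(\mathcal A)$, and $\dim\mathcal L(\alpha)=2$ if and only if $\alpha\in E(\mathcal A)$.
   Context: Setting: $m\ge 1$ and $0<k_1<\dots<k_m<d$ are integers with $\gcd(k_1,\dots,k_m,d)=1$; $\Lambda=\{0,k_1,\dots,k_m,d\}$, and all $(m+2)$-tuples are indexed by $\Lambda$. $\mathbb N=\{0,1,2,\dots\}$. $\mathcal A$ is the $2\times(m+2)$ integer matrix whose columns are $(1,j)^T$, $j\in\Lambda$. Variables $x=(x_j)_{j\in\Lambda}$. The $\mathcal A$-hypergeometric system with exponent $\alpha=(\alpha_1,\alpha_2)$ consists of the equations $\prod_{v_j>0}(\partial/\partial x_j)^{v_j}\varphi=\prod_{v_j<0}(\partial/\partial x_j)^{-v_j}\varphi$ for all $v\in\mathbb Z^{\Lambda}$ with $\mathcal A v=0$, together with $\sum_{j\in\Lambda}x_j\,\partial\varphi/\partial x_j=\alpha_1\varphi$ and $\sum_{j\in\Lambda}j\,x_j\,\partial\varphi/\partial x_j=\alpha_2\varphi$. Let $\mathcal B$ be the matrix obtained from $\mathcal A$ by deleting the column $(1,d)^T$ and $\mathcal C$ the matrix obtained by deleting the column $(1,0)^T$.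 Put $I(\mathcal A)=\mathcal A\cdot\mathbb N^{m+2}$, $F_0(\mathcal A)=\mathcal C\cdot\mathbb N^{m+1}-\mathbb N(1,0)$, $F_d(\mathcal A)=\mathcal B\cdot\mathbb N^{m+1}-\mathbb N(1,d)$, $E_0(\mathcal A)=F_0(\mathcal A)\setminus I(\mathcal A)$, $E_d(\mathcal A)=F_d(\mathcal A)\setminus I(\mathcal A)$, $E(\mathcal A)=E_0(\mathcal A)\cap E_d(\mathcal A)$ (all subsets of $\mathbb Z^2$). *)

theory Defs
  imports Complex_Main "HOL-Library.Poly_Mapping" "HOL-Library.Product_Plus"
begin

section \<open>Laurent polynomials\<close>

text \<open>
  The monoid algebra of the integer exponent vectors (finitely supported functions on the
  variable indices, so that \<^term>\<open>Poly_Mapping.lookup a j\<close> is the possibly negative exponent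
  of the \<open>j\<close>-th variable in the monomial with exponent vector \<open>a\<close>).
\<close>

type_synonym laurent = "(nat \<Rightarrow>\<^sub>0 int) \<Rightarrow>\<^sub>0 complex"

definition laurent_var :: "nat \<Rightarrow> laurent" where
  "laurent_var j = Poly_Mapping.single (Poly_Mapping.single j 1) 1"

definition laurent_scale :: "complex \<Rightarrow> laurent \<Rightarrow> laurent" where
  "laurent_scale c p = Poly_Mapping.single 0 c * p"

global_interpretation laurent: vector_space laurent_scale
  by unfold_locales
    (simp_all add: laurent_scale_def distrib_left distrib_right single_add mult_single
      flip: mult.assoc)

definition laurents_in :: "nat set \<Rightarrow> laurent set" where
  "laurents_in \<Lambda> = {p. \<forall>a \<in> Poly_Mapping.keys p. Poly_Mapping.keys a \<subseteq> \<Lambda>}"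

text \<open>Formal partial derivative: the monomial \<open>x\<^sup>a\<close> goes to \<open>a\<^sub>j x\<^sup>a / x\<^sub>j\<close>.\<close>

definition partial :: "nat \<Rightarrow> laurent \<Rightarrow> laurent" where
  "partial j p =
    (\<Sum>a \<in> Poly_Mapping.keys p.
      Poly_Mapping.single (a - Poly_Mapping.single j 1)
        (of_int (Poly_Mapping.lookup a j) * Poly_Mapping.lookup p a))"

text \<open>
  The operator \<open>\<Prod>\<^bsub>j \<in> \<Lambda>, v j > 0\<^esub> (\<partial>/\<partial>x\<^sub>j)\<^bsup>v j\<^esup>\<close>: as \<^const>\<open>nat\<close> sends negative integers
  to \<open>0\<close>, the factors with \<open>v j \<le> 0\<close> are the identity.  The partial derivatives commute, so
  the order of composition is immaterial.
\<close>

definition partials_pos :: "nat set \<Rightarrow> (nat \<Rightarrow> int) \<Rightarrow> laurent \<Rightarrow> laurent" where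
  "partials_pos \<Lambda> v = foldr (\<lambda>j. partial j ^^ nat (v j)) (sorted_list_of_set \<Lambda>)"


section \<open>Integer matrices with columns \<open>(1, j)\<close>\<close>

text \<open>
  The matrix with columns \<open>(1, j)\<close>, \<open>j \<in> S\<close>, is represented by its index set \<open>S\<close>; deleting a
  column means removing an index. Vectors are functions of which only the values on \<open>S\<close> matter.
\<close>

definition mat_vec :: "nat set \<Rightarrow> (nat \<Rightarrow> int) \<Rightarrow> int \<times> int" where
  "mat_vec S v = (\<Sum>j\<in>S. v j, \<Sum>j\<in>S. int j * v j)"

definition nat_combs :: "nat set \<Rightarrow> (int \<times> int) set" where
  "nat_combs S = {mat_vec S (\<lambda>j. int (u j)) | u :: nat \<Rightarrow> nat. True}"

definition index_set :: "nat \<Rightarrow> (nat \<Rightarrow> nat) \<Rightarrow> nat \<Rightarrow> nat set" where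
  "index_set m k d = {0} \<union> k ` {1..m} \<union> {d}"

text \<open>In the following, \<open>\<Lambda>\<close> is an index set with least element \<open>0\<close> and greatest element \<open>d\<close>.\<close>

definition I_set :: "nat set \<Rightarrow> (int \<times> int) set" where
  "I_set \<Lambda> = nat_combs \<Lambda>"

definition F0_set :: "nat set \<Rightarrow> (int \<times> int) set" where
  "F0_set \<Lambda> = {c - (int n, 0) | c n. c \<in> nat_combs (\<Lambda> - {0})}"

definition Fd_set :: "nat set \<Rightarrow> nat \<Rightarrow> (int \<times> int) set" where
  "Fd_set \<Lambda> d = {c - (int n, int n * int d) | c n. c \<in> nat_combs (\<Lambda> - {d})}"

definition E0_set :: "nat set \<Rightarrow> (int \<times> int) set" where
  "E0_set \<Lambda> = F0_set \<Lambda> - I_set \<Lambda>"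

definition Ed_set :: "nat set \<Rightarrow> nat \<Rightarrow> (int \<times> int) set" where
  "Ed_set \<Lambda> d = Fd_set \<Lambda> d - I_set \<Lambda>"

definition E_set :: "nat set \<Rightarrow> nat \<Rightarrow> (int \<times> int) set" where
  "E_set \<Lambda> d = E0_set \<Lambda> \<inter> Ed_set \<Lambda> d"


section \<open>The hypergeometric system\<close>

definition solves_hypergeometric :: "nat set \<Rightarrow> complex \<Rightarrow> complex \<Rightarrow> laurent \<Rightarrow> bool" where
  "solves_hypergeometric \<Lambda> \<alpha>\<^sub>1 \<alpha>\<^sub>2 \<phi> \<longleftrightarrow>
    (\<forall>v :: nat \<Rightarrow> int. mat_vec \<Lambda> v = 0 \<longrightarrow>
      partials_pos \<Lambda> v \<phi> = partials_pos \<Lambda> (\<lambda>j. - v j) \<phi>) \<and>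
    (\<Sum>j\<in>\<Lambda>. laurent_var j * partial j \<phi>) = laurent_scale \<alpha>\<^sub>1 \<phi> \<and>
    (\<Sum>j\<in>\<Lambda>. laurent_scale (of_nat j) (laurent_var j * partial j \<phi>)) = laurent_scale \<alpha>\<^sub>2 \<phi>"

definition laurent_solutions :: "nat set \<Rightarrow> complex \<Rightarrow> complex \<Rightarrow> laurent set" where
  "laurent_solutions \<Lambda> \<alpha>\<^sub>1 \<alpha>\<^sub>2 = {\<phi> \<in> laurents_in \<Lambda>. solves_hypergeometric \<Lambda> \<alpha>\<^sub>1 \<alpha>\<^sub>2 \<phi>}"

end

theory Submission
  imports Defs
begin

text \<open>
  Every solution is supported on the \<^emph>\<open>fiber\<close> of \<open>\<alpha>\<close>, the exponent vectors \<open>a\<close> with \<open>\<A> a = \<alpha>\<close>; this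
  is what the two Euler equations say.  Divide the coefficient of \<open>x\<^sup>a\<close> by the product over \<open>j\<close> of
  \<open>1 / a\<^sub>j!\<close> (for \<open>a\<^sub>j \<ge> 0\<close>) or \<open>\<plusminus> (- a\<^sub>j - 1)!\<close> (for \<open>a\<^sub>j < 0\<close>).  On coefficients normalized in this
  way a partial derivative is a mere shift of the exponent, except that it kills every monomial in
  which it would make a nonnegative exponent negative.  The remaining equations therefore compare
  any two points \<open>a\<close>, \<open>a'\<close> of the fiber, and only their sets of negative coordinates matter: the
  normalized coefficient is the same at points with the same negative set, and it vanishes at a
  point whose negative set properly contains another one that occurs
  (\<open>laurent_solutions_iff\<close>).

  Hence, for every finite set of columns, a basis of the solutions is indexed by the negative sets
  that occur in the fiber, are minimal there, and are attained at only finitely many points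
  (\<open>laurent_solutions_basis\<close>).

  For a monomial curve such a negative set can only be \<open>\<emptyset>\<close>, \<open>{0}\<close> or \<open>{d}\<close>.  Indeed, from a point
  with such a negative set one cannot move along a nonzero relation whose negative entries lie in
  that set: the negative set cannot grow along the ray, so by minimality it is constant, and the
  ray has infinitely many points.  For an inner column \<open>j\<close> the relation
  \<open>(d - j) e\<^sub>0 - d e\<^sub>j + j e\<^sub>d\<close> excludes that \<open>j\<close> is in the set, and its negative excludes that both
  \<open>0\<close> and \<open>d\<close> are.  The set \<open>\<emptyset>\<close> qualifies iff \<open>\<alpha> \<in> I\<close>, the set \<open>{0}\<close> iff \<open>\<alpha> \<in> E\<^sub>0\<close>,
  the set \<open>{d}\<close> iff \<open>\<alpha> \<in> E\<^sub>d\<close>.  So the dimension is the number of the sets \<open>I\<close>, \<open>E\<^sub>0\<close>, \<open>E\<^sub>d\<close> that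
  contain \<open>\<alpha>\<close>, and \<open>I\<close> is disjoint from the other two.
\<close>


section \<open>Exponent vectors and fibers\<close>

definition exponent_vec :: "nat set \<Rightarrow> (nat \<Rightarrow> int) \<Rightarrow> (nat \<Rightarrow>\<^sub>0 int)" where
  "exponent_vec S f = (\<Sum>j\<in>S. Poly_Mapping.single j (f j))"

lemma lookup_exponent_vec:
  "finite S \<Longrightarrow> Poly_Mapping.lookup (exponent_vec S f) i = (if i \<in> S then f i else 0)"
  by (simp add: exponent_vec_def lookup_sum lookup_single when_def)

lemma keys_exponent_vec: "finite S \<Longrightarrow> Poly_Mapping.keys (exponent_vec S f) \<subseteq> S"
  by (auto simp: in_keys_iff lookup_exponent_vec split: if_splits)

lemma lookup_outside: "Poly_Mapping.keys a \<subseteq> S \<Longrightarrow> i \<notin> S \<Longrightarrow> Poly_Mapping.lookup a i = 0"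
  by (auto simp: in_keys_iff)

lemma mat_vec_cong: "(\<And>j. j \<in> S \<Longrightarrow> f j = g j) \<Longrightarrow> mat_vec S f = mat_vec S g"
  by (simp add: mat_vec_def)

lemma mat_vec_add: "mat_vec S (\<lambda>j. f j + g j) = mat_vec S f + mat_vec S g"
  by (simp add: mat_vec_def sum.distrib algebra_simps)

lemma mat_vec_diff: "mat_vec S (\<lambda>j. f j - g j) = mat_vec S f - mat_vec S g"
  by (simp add: mat_vec_def sum_subtractf algebra_simps)

lemma mat_vec_scale_zero: "mat_vec S v = 0 \<Longrightarrow> mat_vec S (\<lambda>j. t * v j) = 0"
  by (simp add: mat_vec_def zero_prod_def mult.left_commute[of _ t] flip: sum_distrib_left)

lemma mat_vec_remove:
  "finite S \<Longrightarrow> z \<in> S \<Longrightarrow> mat_vec S f = (f z, int z * f z) + mat_vec (S - {z}) f"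
  by (simp add: mat_vec_def sum.remove)

definition fiber :: "nat set \<Rightarrow> int \<times> int \<Rightarrow> (nat \<Rightarrow>\<^sub>0 int) set" where
  "fiber \<Lambda> \<alpha> = {a. Poly_Mapping.keys a \<subseteq> \<Lambda> \<and> mat_vec \<Lambda> (Poly_Mapping.lookup a) = \<alpha>}"

definition negatives :: "(nat \<Rightarrow>\<^sub>0 int) \<Rightarrow> nat set" where
  "negatives a = {j. Poly_Mapping.lookup a j < 0}"

lemma negatives_subset: "a \<in> fiber \<Lambda> \<alpha> \<Longrightarrow> negatives a \<subseteq> \<Lambda>"
  by (auto simp: fiber_def negatives_def in_keys_iff subset_iff)

lemma exponent_vec_in_fiber:
  "finite \<Lambda> \<Longrightarrow> mat_vec \<Lambda> f = \<alpha> \<Longrightarrow> exponent_vec \<Lambda> f \<in> fiber \<Lambda> \<alpha>"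
  by (simp add: fiber_def keys_exponent_vec lookup_exponent_vec cong: mat_vec_cong)


section \<open>Coefficients of derivatives\<close>

lemma lookup_single_times:
  fixes p :: laurent
  shows "Poly_Mapping.lookup (Poly_Mapping.single s c * p) a = c * Poly_Mapping.lookup p (a - s)"
proof -
  have "Poly_Mapping.lookup (Poly_Mapping.single s c * p) a
      = (\<Sum>l. (c when s = l) * Poly_Mapping.lookup p (a - l))"
  proof (subst lookup_mult, intro Sum_any.cong arg_cong2[where f = times])
    fix l
    have "(\<Sum>q. Poly_Mapping.lookup p q when a = l + q)
        = (\<Sum>q. Poly_Mapping.lookup p q when q = a - l)"
      by (intro Sum_any.cong when_cong) (auto simp: algebra_simps)
    then show "(\<Sum>q. Poly_Mapping.lookup p q when a = l + q) = Poly_Mapping.lookup p (a - l)"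
      by simp
  qed (simp add: lookup_single)
  also have "\<dots> = c * Poly_Mapping.lookup p (a - s)"
    by (simp add: when_mult)
  finally show ?thesis .
qed

lemma lookup_laurent_scale:
  "Poly_Mapping.lookup (laurent_scale c p) a = c * Poly_Mapping.lookup p a"
  by (simp add: laurent_scale_def lookup_single_times)

lemma lookup_partial:
  "Poly_Mapping.lookup (partial j p) b
    = of_int (Poly_Mapping.lookup b j + 1) * Poly_Mapping.lookup p (b + Poly_Mapping.single j 1)"
proof -
  have shift: "a - Poly_Mapping.single j 1 = b \<longleftrightarrow> a = b + Poly_Mapping.single j 1"
    for a :: "nat \<Rightarrow>\<^sub>0 int"
    by (auto simp: algebra_simps)
  show ?thesis
    by (auto simp: partial_def lookup_sum lookup_single shift when_def lookup_add in_keys_iff)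
qed

lemma lookup_partial_funpow:
  "Poly_Mapping.lookup ((partial j ^^ n) p) b
    = pochhammer (of_int (Poly_Mapping.lookup b j + 1)) n
      * Poly_Mapping.lookup p (b + Poly_Mapping.single j (int n))"
proof (induction n arbitrary: b)
  case (Suc n)
  then show ?case
    by (simp add: lookup_partial pochhammer_rec lookup_add single_add add_ac)
qed simp

lemma lookup_partials:
  assumes "distinct js"
  shows "Poly_Mapping.lookup (foldr (\<lambda>j. partial j ^^ u j) js p) b
    = (\<Prod>j\<in>set js. pochhammer (of_int (Poly_Mapping.lookup b j + 1)) (u j))
      * Poly_Mapping.lookup p (b + exponent_vec (set js) (\<lambda>j. int (u j)))"
  using assms
proof (induction js arbitrary: b)
  case (Cons i js)
  then have "(\<Prod>j\<in>set js. pochhammer (of_int (Poly_Mapping.lookup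
        (b + Poly_Mapping.single i (int (u i))) j + 1)) (u j) :: complex)
    = (\<Prod>j\<in>set js. pochhammer (of_int (Poly_Mapping.lookup b j + 1)) (u j))"
    by (intro prod.cong) (auto simp: lookup_add lookup_single when_def)
  with Cons show ?case
    by (simp add: lookup_partial_funpow exponent_vec_def add_ac)
qed (simp add: exponent_vec_def)

lemma lookup_partials_pos:
  assumes "finite \<Lambda>"
  shows "Poly_Mapping.lookup (partials_pos \<Lambda> v p) b
    = (\<Prod>j\<in>\<Lambda>. pochhammer (of_int (Poly_Mapping.lookup b j + 1)) (nat (v j)))
      * Poly_Mapping.lookup p (b + exponent_vec \<Lambda> (\<lambda>j. int (nat (v j))))"
  using assms by (simp add: partials_pos_def lookup_partials)

lemma lookup_euler:
  "Poly_Mapping.lookup (laurent_var j * partial j p) a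
    = of_int (Poly_Mapping.lookup a j) * Poly_Mapping.lookup p a"
  by (simp add: laurent_var_def lookup_single_times lookup_partial lookup_minus)


section \<open>Normalized coefficients\<close>

text \<open>
  These are the values of \<open>1 / \<Gamma>(n + 1)\<close> for \<open>n \<ge> 0\<close> and, where that expression vanishes, the
  reciprocal of the residue of \<open>\<Gamma>\<close> at its pole \<open>n + 1\<close>: a sequence that satisfies the functional equation of
  \<open>1 / \<Gamma>\<close> everywhere except between \<open>-1\<close> and \<open>0\<close>.
\<close>

definition gamma_factor :: "int \<Rightarrow> complex" where
  "gamma_factor n = (if 0 \<le> n then 1 / fact (nat n) else (- 1) ^ nat (- n - 1) * fact (nat (- n - 1)))"

lemma gamma_factor_nonzero [simp]: "gamma_factor n \<noteq> 0"
  by (simp add: gamma_factor_def)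

lemma gamma_factor_step:
  "of_int (n + 1) * gamma_factor (n + 1) = (if n = - 1 then 0 else gamma_factor n)"
proof (cases "0 \<le> n")
  case True
  then obtain k where "n = int k"
    using zero_le_imp_eq_int by blast
  moreover have "1 + of_nat k \<noteq> (0 :: complex)"
    by (metis of_nat_Suc of_nat_neq_0)
  ultimately show ?thesis
    by (simp add: gamma_factor_def nat_add_distrib fact_Suc add_ac)
next
  case False
  show ?thesis
  proof (cases "n = - 1")
    case True
    then show ?thesis by simp
  next
    case ne: False
    with False have "n = - int (nat (- n - 2)) - 2"
      by simp
    then obtain k where k: "n = - int k - 2" ..
    have g: "gamma_factor n = (- 1) ^ Suc k * fact (Suc k)"
      by (simp add: gamma_factor_def k nat_add_distrib)
    have g': "gamma_factor (n + 1) = (- 1) ^ k * fact k"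
      by (simp add: gamma_factor_def k)
    have n: "of_int (n + 1) = - (of_nat (Suc k) :: complex)"
      by (simp add: k)
    show ?thesis
      unfolding g g' n using ne by (simp add: algebra_simps)
  qed
qed

text \<open>
  Differentiating \<open>x\<^bsup>n + u\<^esup>\<close> (\<open>u\<close> times) multiplies by this rising factorial; it contains the factor
  zero exactly when the exponent passes from nonnegative to negative.
\<close>

lemma gamma_factor_pochhammer:
  "pochhammer (of_int (n + 1)) u * gamma_factor (n + int u)
    = (if n < 0 \<longleftrightarrow> n + int u < 0 then gamma_factor n else 0)"
proof (induction u)
  case (Suc u)
  have "pochhammer (of_int (n + 1)) (Suc u) * gamma_factor (n + int (Suc u))
      = pochhammer (of_int (n + 1)) u * (of_int (n + int u + 1) * gamma_factor (n + int u + 1))"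
    by (simp add: pochhammer_Suc algebra_simps)
  also have "\<dots> = (if n + int u = - 1 then 0
      else pochhammer (of_int (n + 1)) u * gamma_factor (n + int u))"
    unfolding gamma_factor_step by simp
  finally show ?case
    using Suc by auto
qed simp

definition gamma_coeff :: "(nat \<Rightarrow>\<^sub>0 int) \<Rightarrow> complex" where
  "gamma_coeff a = (\<Prod>j\<in>Poly_Mapping.keys a. gamma_factor (Poly_Mapping.lookup a j))"

lemma gamma_coeff_nonzero [simp]: "gamma_coeff a \<noteq> 0"
  by (simp add: gamma_coeff_def)

lemma gamma_coeff_superset:
  "finite \<Lambda> \<Longrightarrow> Poly_Mapping.keys a \<subseteq> \<Lambda> \<Longrightarrow>
    gamma_coeff a = (\<Prod>j\<in>\<Lambda>. gamma_factor (Poly_Mapping.lookup a j))"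
  unfolding gamma_coeff_def
  by (rule prod.mono_neutral_left) (auto simp: in_keys_iff gamma_factor_def)

definition normalized_coeff :: "laurent \<Rightarrow> (nat \<Rightarrow>\<^sub>0 int) \<Rightarrow> complex" where
  "normalized_coeff p a = Poly_Mapping.lookup p a / gamma_coeff a"

lemma lookup_normalized: "Poly_Mapping.lookup p a = gamma_coeff a * normalized_coeff p a"
  by (simp add: normalized_coeff_def)

lemma gamma_coeff_shift:
  fixes u :: "nat \<Rightarrow> nat"
  assumes "finite \<Lambda>" and "Poly_Mapping.keys b \<subseteq> \<Lambda>"
  defines "a \<equiv> b + exponent_vec \<Lambda> (\<lambda>j. int (u j))"
  shows "(\<Prod>j\<in>\<Lambda>. pochhammer (of_int (Poly_Mapping.lookup b j + 1)) (u j)) * gamma_coeff a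
    = (if negatives a = negatives b then gamma_coeff b else 0)"
proof -
  have la: "Poly_Mapping.lookup a j = Poly_Mapping.lookup b j + (if j \<in> \<Lambda> then int (u j) else 0)" for j
    using assms by (simp add: lookup_add lookup_exponent_vec)
  have keys: "Poly_Mapping.keys a \<subseteq> \<Lambda>"
    using la assms(2) by (auto simp: in_keys_iff subset_iff split: if_splits)
  have "(\<Prod>j\<in>\<Lambda>. pochhammer (of_int (Poly_Mapping.lookup b j + 1)) (u j)) * gamma_coeff a
      = (\<Prod>j\<in>\<Lambda>. if Poly_Mapping.lookup b j < 0 \<longleftrightarrow> Poly_Mapping.lookup a j < 0
                then gamma_factor (Poly_Mapping.lookup b j) else 0)"
    unfolding gamma_coeff_superset[OF assms(1) keys] prod.distrib[symmetric]
    by (intro prod.cong) (simp_all only: la if_True gamma_factor_pochhammer)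
  also have "\<dots> = (if negatives a = negatives b then gamma_coeff b else 0)"
  proof (cases "negatives a = negatives b")
    case True
    then have "Poly_Mapping.lookup b j < 0 \<longleftrightarrow> Poly_Mapping.lookup a j < 0" for j
      by (auto simp: negatives_def)
    then show ?thesis
      using True by (simp add: gamma_coeff_superset[OF assms(1,2)])
  next
    case False
    then obtain j where j: "(Poly_Mapping.lookup b j < 0) \<noteq> (Poly_Mapping.lookup a j < 0)"
      by (auto simp: negatives_def)
    then have "j \<in> \<Lambda>"
      by (auto simp: la split: if_splits)
    with j False show ?thesis
      using assms(1) by (auto intro!: prod_zero)
  qed
  finally show ?thesis .
qed

lemma lookup_partials_pos_normalized:
  assumes "finite \<Lambda>" and "Poly_Mapping.keys b \<subseteq> \<Lambda>"
  defines "a \<equiv> \<lambda>v. b + exponent_vec \<Lambda> (\<lambda>j. int (nat (v j)))"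
  shows "Poly_Mapping.lookup (partials_pos \<Lambda> v p) b
    = (if negatives (a v) = negatives b then gamma_coeff b * normalized_coeff p (a v) else 0)"
  using gamma_coeff_shift[OF assms(1,2), of "\<lambda>j. nat (v j)"]
  by (simp add: lookup_partials_pos[OF assms(1)] lookup_normalized[of p] a_def
      flip: mult.assoc)


section \<open>Combinatorial form of the hypergeometric system\<close>

lemma euler_equations_iff:
  "(\<Sum>j\<in>\<Lambda>. laurent_var j * partial j p) = laurent_scale (of_int \<alpha>\<^sub>1) p \<and>
    (\<Sum>j\<in>\<Lambda>. laurent_scale (of_nat j) (laurent_var j * partial j p)) = laurent_scale (of_int \<alpha>\<^sub>2) p
   \<longleftrightarrow> (\<forall>a\<in>Poly_Mapping.keys p. mat_vec \<Lambda> (Poly_Mapping.lookup a) = (\<alpha>\<^sub>1, \<alpha>\<^sub>2))"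
proof -
  let ?l = "Poly_Mapping.lookup"
  have 1: "?l (\<Sum>j\<in>\<Lambda>. laurent_var j * partial j p) a = of_int (\<Sum>j\<in>\<Lambda>. ?l a j) * ?l p a" for a
    by (simp add: lookup_sum lookup_euler sum_distrib_right)
  have 2: "?l (\<Sum>j\<in>\<Lambda>. laurent_scale (of_nat j) (laurent_var j * partial j p)) a
      = of_int (\<Sum>j\<in>\<Lambda>. int j * ?l a j) * ?l p a" for a
    by (simp add: lookup_sum lookup_euler lookup_laurent_scale sum_distrib_right mult.assoc)
  show ?thesis
    by (simp only: poly_mapping_eq_iff fun_eq_iff 1 2 lookup_laurent_scale mult_cancel_right
        of_int_eq_iff mat_vec_def prod.inject in_keys_iff Ball_def) blast
qed

text \<open>
  A relation \<open>v\<close> and an exponent \<open>b\<close> amount to two points \<open>b + v\<^sup>+\<close> and \<open>b + v\<^sup>-\<close> of a common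
  fiber whose coordinatewise minimum is \<open>b\<close>.  Up to a common nonzero factor, the coefficients of
  \<open>x\<^sup>b\<close> in the two derivatives are the normalized coefficients at those points, each present only if
  its negative set is that of the minimum, which is the union of both negative sets.
\<close>

lemma laurent_solutions_iff:
  assumes "finite \<Lambda>"
  shows "p \<in> laurent_solutions \<Lambda> (of_int \<alpha>\<^sub>1) (of_int \<alpha>\<^sub>2) \<longleftrightarrow>
    Poly_Mapping.keys p \<subseteq> fiber \<Lambda> (\<alpha>\<^sub>1, \<alpha>\<^sub>2) \<and>
    (\<forall>a\<in>fiber \<Lambda> (\<alpha>\<^sub>1, \<alpha>\<^sub>2). \<forall>a'\<in>fiber \<Lambda> (\<alpha>\<^sub>1, \<alpha>\<^sub>2). negatives a' \<subseteq> negatives a \<longrightarrow>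
      normalized_coeff p a = (if negatives a' = negatives a then normalized_coeff p a' else 0))"
    (is "_ \<longleftrightarrow> ?supp \<and> ?compat")
proof -
  let ?F = "fiber \<Lambda> (\<alpha>\<^sub>1, \<alpha>\<^sub>2)"
  let ?toric = "\<forall>v. mat_vec \<Lambda> v = 0 \<longrightarrow> partials_pos \<Lambda> v p = partials_pos \<Lambda> (\<lambda>j. - v j) p"
  have "p \<in> laurent_solutions \<Lambda> (of_int \<alpha>\<^sub>1) (of_int \<alpha>\<^sub>2) \<longleftrightarrow> ?supp \<and> ?toric"
    unfolding laurent_solutions_def solves_hypergeometric_def euler_equations_iff
    by (auto simp: laurents_in_def fiber_def)
  moreover have "?toric \<longleftrightarrow> ?compat" if supp: ?supp
  proof
    assume toric: ?toric
    show ?compat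
    proof (intro ballI impI)
      fix a a' assume a: "a \<in> ?F" and a': "a' \<in> ?F" and sub: "negatives a' \<subseteq> negatives a"
      define v where "v j = Poly_Mapping.lookup a j - Poly_Mapping.lookup a' j" for j
      define b where
        "b = exponent_vec \<Lambda> (\<lambda>j. min (Poly_Mapping.lookup a j) (Poly_Mapping.lookup a' j))"
      have out: "Poly_Mapping.lookup a j = 0" "Poly_Mapping.lookup a' j = 0" if "j \<notin> \<Lambda>" for j
        using a a' that by (auto simp: fiber_def intro: lookup_outside)
      have "mat_vec \<Lambda> v = 0"
        using a a' by (simp add: v_def[abs_def] mat_vec_diff fiber_def)
      then have eq: "Poly_Mapping.lookup (partials_pos \<Lambda> v p) b
          = Poly_Mapping.lookup (partials_pos \<Lambda> (\<lambda>j. - v j) p) b"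
        using toric by simp
      have keys: "Poly_Mapping.keys b \<subseteq> \<Lambda>"
        using assms by (simp add: b_def keys_exponent_vec)
      have "b + exponent_vec \<Lambda> (\<lambda>j. int (nat (v j))) = a"
        "b + exponent_vec \<Lambda> (\<lambda>j. int (nat (- v j))) = a'"
        using out assms
        by (auto intro!: poly_mapping_eqI simp: b_def v_def lookup_add lookup_exponent_vec)
      moreover have "negatives b = negatives a"
      proof -
        have "Poly_Mapping.lookup b j = min (Poly_Mapping.lookup a j) (Poly_Mapping.lookup a' j)" for j
          using out assms by (simp add: b_def lookup_exponent_vec)
        then show ?thesis
          using sub by (auto simp: negatives_def min_def subset_iff)
      qed
      ultimately show "normalized_coeff p a
          = (if negatives a' = negatives a then normalized_coeff p a' else 0)"
        using eq by (simp add: lookup_partials_pos_normalized[OF assms keys] split: if_splits)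
    qed
  next
    assume compat: ?compat
    show ?toric
    proof (intro allI impI poly_mapping_eqI)
      fix v b assume v: "mat_vec \<Lambda> v = 0"
      define a a' where "a = b + exponent_vec \<Lambda> (\<lambda>j. int (nat (v j)))"
        and "a' = b + exponent_vec \<Lambda> (\<lambda>j. int (nat (- v j)))"
      have la: "Poly_Mapping.lookup a j = Poly_Mapping.lookup b j + (if j \<in> \<Lambda> then int (nat (v j)) else 0)"
        and la': "Poly_Mapping.lookup a' j
          = Poly_Mapping.lookup b j + (if j \<in> \<Lambda> then int (nat (- v j)) else 0)" for j
        using assms by (simp_all add: a_def a'_def lookup_add lookup_exponent_vec)
      show "Poly_Mapping.lookup (partials_pos \<Lambda> v p) b
          = Poly_Mapping.lookup (partials_pos \<Lambda> (\<lambda>j. - v j) p) b"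
      proof (cases "a \<in> ?F \<and> a' \<in> ?F")
        case True
        have keys: "Poly_Mapping.keys b \<subseteq> \<Lambda>"
        proof
          fix j assume "j \<in> Poly_Mapping.keys b"
          then have "j \<notin> \<Lambda> \<Longrightarrow> j \<in> Poly_Mapping.keys a"
            by (simp add: in_keys_iff la)
          then show "j \<in> \<Lambda>"
            using True unfolding fiber_def by blast
        qed
        have b: "Poly_Mapping.lookup b j = min (Poly_Mapping.lookup a j) (Poly_Mapping.lookup a' j)" for j
          by (simp add: la la' min_def)
        have negs: "negatives b = negatives a \<union> negatives a'"
          unfolding negatives_def b by auto
        have *: "normalized_coeff p x = (if negatives y = negatives x then normalized_coeff p y else 0)"
          if "negatives y \<subseteq> negatives x" "x \<in> {a, a'}" "y \<in> {a, a'}" for x y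
          by (rule compat[rule_format]) (use True that in auto)
        have "(if negatives a = negatives b then normalized_coeff p a else 0)
            = (if negatives a' = negatives b then normalized_coeff p a' else 0)"
        proof (cases "negatives a = negatives b")
          case True
          with negs have "negatives a' \<subseteq> negatives a"
            by blast
          from *[OF this] True show ?thesis
            by simp
        next
          case False
          have "normalized_coeff p a' = 0" if eq: "negatives a' = negatives b"
          proof -
            from eq negs have "negatives a \<subseteq> negatives a'"
              by blast
            from *[OF this] False eq show ?thesis
              by simp
          qed
          with False show ?thesis
            by simp
        qed
        then show ?thesis
          by (simp add: lookup_partials_pos_normalized[OF assms keys] a_def a'_def split: if_splits)
      next
        case False
        \<comment> \<open>The two points lie in the same fiber, so if one is outside the fiber of \<open>\<alpha>\<close> then both are.\<close>
        have "mat_vec \<Lambda> (Poly_Mapping.lookup a) - mat_vec \<Lambda> (Poly_Mapping.lookup a') = mat_vec \<Lambda> v"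
          unfolding mat_vec_diff[symmetric] by (rule mat_vec_cong) (simp add: la la')
        with v have "mat_vec \<Lambda> (Poly_Mapping.lookup a) = mat_vec \<Lambda> (Poly_Mapping.lookup a')"
          by simp
        moreover have "Poly_Mapping.keys a \<subseteq> \<Lambda> \<longleftrightarrow> Poly_Mapping.keys a' \<subseteq> \<Lambda>"
          by (auto simp: subset_iff in_keys_iff la la')
        ultimately have "a \<notin> ?F" "a' \<notin> ?F"
          using False by (auto simp: fiber_def)
        with supp have "Poly_Mapping.lookup p a = 0" "Poly_Mapping.lookup p a' = 0"
          by (auto simp: in_keys_iff)
        then show ?thesis
          using assms by (simp add: lookup_partials_pos a_def a'_def)
      qed
    qed
  qed
  ultimately show ?thesis
    by blast
qed


section \<open>A basis of the Laurent polynomial solutions\<close>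

definition sign_class :: "nat set \<Rightarrow> int \<times> int \<Rightarrow> nat set \<Rightarrow> (nat \<Rightarrow>\<^sub>0 int) set" where
  "sign_class \<Lambda> \<alpha> N = {a \<in> fiber \<Lambda> \<alpha>. negatives a = N}"

definition finite_minimal_negatives :: "nat set \<Rightarrow> int \<times> int \<Rightarrow> nat set set" where
  "finite_minimal_negatives \<Lambda> \<alpha> = {N. sign_class \<Lambda> \<alpha> N \<noteq> {} \<and> finite (sign_class \<Lambda> \<alpha> N)
    \<and> (\<forall>a\<in>fiber \<Lambda> \<alpha>. negatives a \<subseteq> N \<longrightarrow> negatives a = N)}"

definition class_solution :: "nat set \<Rightarrow> int \<times> int \<Rightarrow> nat set \<Rightarrow> laurent" where
  "class_solution \<Lambda> \<alpha> N = (\<Sum>a\<in>sign_class \<Lambda> \<alpha> N. Poly_Mapping.single a (gamma_coeff a))"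

lemma lookup_class_solution:
  "finite (sign_class \<Lambda> \<alpha> N) \<Longrightarrow> Poly_Mapping.lookup (class_solution \<Lambda> \<alpha> N) a
    = (if a \<in> sign_class \<Lambda> \<alpha> N then gamma_coeff a else 0)"
  by (simp add: class_solution_def lookup_sum lookup_single when_def)

lemma finite_finite_minimal_negatives:
  assumes "finite \<Lambda>"
  shows "finite (finite_minimal_negatives \<Lambda> \<alpha>)"
proof (rule finite_subset)
  show "finite_minimal_negatives \<Lambda> \<alpha> \<subseteq> Pow \<Lambda>"
    by (auto simp: finite_minimal_negatives_def sign_class_def dest: negatives_subset)
qed (use assms in simp)

lemma lookup_class_combination:
  fixes M :: "nat set set"
  assumes "finite \<Lambda>" and M: "M = finite_minimal_negatives \<Lambda> \<alpha>"
  shows "Poly_Mapping.lookup (\<Sum>N\<in>M. laurent_scale (t N) (class_solution \<Lambda> \<alpha> N)) a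
    = (if a \<in> fiber \<Lambda> \<alpha> \<and> negatives a \<in> M then t (negatives a) * gamma_coeff a else 0)"
proof -
  have "Poly_Mapping.lookup (\<Sum>N\<in>M. laurent_scale (t N) (class_solution \<Lambda> \<alpha> N)) a
      = (\<Sum>N\<in>M. if negatives a = N then (if a \<in> fiber \<Lambda> \<alpha> then t N * gamma_coeff a else 0) else 0)"
    unfolding lookup_sum lookup_laurent_scale
  proof (rule sum.cong)
    fix N assume "N \<in> M"
    then have "finite (sign_class \<Lambda> \<alpha> N)"
      by (simp add: M finite_minimal_negatives_def)
    then show "t N * Poly_Mapping.lookup (class_solution \<Lambda> \<alpha> N) a
        = (if negatives a = N then (if a \<in> fiber \<Lambda> \<alpha> then t N * gamma_coeff a else 0) else 0)"
      by (auto simp: lookup_class_solution sign_class_def)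
  qed simp
  also have "\<dots> = (if a \<in> fiber \<Lambda> \<alpha> \<and> negatives a \<in> M then t (negatives a) * gamma_coeff a else 0)"
    using finite_finite_minimal_negatives[OF assms(1)] by (simp add: M)
  finally show ?thesis .
qed

lemma normalized_coeff_compatible:
  assumes "finite \<Lambda>" and "p \<in> laurent_solutions \<Lambda> (of_int \<alpha>\<^sub>1) (of_int \<alpha>\<^sub>2)"
    and "a \<in> fiber \<Lambda> (\<alpha>\<^sub>1, \<alpha>\<^sub>2)" and "a' \<in> fiber \<Lambda> (\<alpha>\<^sub>1, \<alpha>\<^sub>2)" and "negatives a' \<subseteq> negatives a"
  shows "normalized_coeff p a = (if negatives a' = negatives a then normalized_coeff p a' else 0)"
  using assms(2-5) unfolding laurent_solutions_iff[OF assms(1)] by blast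

lemma subspace_laurent_solutions:
  "finite \<Lambda> \<Longrightarrow> laurent.subspace (laurent_solutions \<Lambda> (of_int \<alpha>\<^sub>1) (of_int \<alpha>\<^sub>2))"
proof (unfold laurent.subspace_def, intro conjI ballI allI)
  assume fin: "finite \<Lambda>"
  let ?L = "laurent_solutions \<Lambda> (of_int \<alpha>\<^sub>1) (of_int \<alpha>\<^sub>2)"
  note iff = laurent_solutions_iff[OF fin]
  show "0 \<in> ?L"
    by (simp add: iff normalized_coeff_def)
  note compat = normalized_coeff_compatible[OF fin, of _ \<alpha>\<^sub>1 \<alpha>\<^sub>2]
  show "p + q \<in> ?L" if p: "p \<in> ?L" and q: "q \<in> ?L" for p q
    unfolding iff
  proof (intro conjI ballI impI)
    show "Poly_Mapping.keys (p + q) \<subseteq> fiber \<Lambda> (\<alpha>\<^sub>1, \<alpha>\<^sub>2)"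
      using p q Poly_Mapping.keys_add[of p q] unfolding iff by blast
    have add: "normalized_coeff (p + q) a = normalized_coeff p a + normalized_coeff q a" for a
      by (simp add: normalized_coeff_def lookup_add add_divide_distrib)
    fix a a' assume "a \<in> fiber \<Lambda> (\<alpha>\<^sub>1, \<alpha>\<^sub>2)" "a' \<in> fiber \<Lambda> (\<alpha>\<^sub>1, \<alpha>\<^sub>2)" "negatives a' \<subseteq> negatives a"
    from compat[OF p this] compat[OF q this]
    show "normalized_coeff (p + q) a
        = (if negatives a' = negatives a then normalized_coeff (p + q) a' else 0)"
      by (simp add: add split: if_splits)
  qed
  show "laurent_scale c p \<in> ?L" if p: "p \<in> ?L" for c p
    unfolding iff
  proof (intro conjI ballI impI)
    show "Poly_Mapping.keys (laurent_scale c p) \<subseteq> fiber \<Lambda> (\<alpha>\<^sub>1, \<alpha>\<^sub>2)"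
      using p unfolding iff by (auto simp: in_keys_iff lookup_laurent_scale subset_iff)
    have scale: "normalized_coeff (laurent_scale c p) a = c * normalized_coeff p a" for a
      by (simp add: normalized_coeff_def lookup_laurent_scale)
    fix a a' assume "a \<in> fiber \<Lambda> (\<alpha>\<^sub>1, \<alpha>\<^sub>2)" "a' \<in> fiber \<Lambda> (\<alpha>\<^sub>1, \<alpha>\<^sub>2)" "negatives a' \<subseteq> negatives a"
    from compat[OF p this]
    show "normalized_coeff (laurent_scale c p) a
        = (if negatives a' = negatives a then normalized_coeff (laurent_scale c p) a' else 0)"
      by (simp add: scale split: if_splits)
  qed
qed

lemma class_solution_is_solution:
  assumes "finite \<Lambda>" and N: "N \<in> finite_minimal_negatives \<Lambda> (\<alpha>\<^sub>1, \<alpha>\<^sub>2)"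
  shows "class_solution \<Lambda> (\<alpha>\<^sub>1, \<alpha>\<^sub>2) N \<in> laurent_solutions \<Lambda> (of_int \<alpha>\<^sub>1) (of_int \<alpha>\<^sub>2)"
proof -
  have fin: "finite (sign_class \<Lambda> (\<alpha>\<^sub>1, \<alpha>\<^sub>2) N)"
    using N by (simp add: finite_minimal_negatives_def)
  have "normalized_coeff (class_solution \<Lambda> (\<alpha>\<^sub>1, \<alpha>\<^sub>2) N) a
      = (if a \<in> sign_class \<Lambda> (\<alpha>\<^sub>1, \<alpha>\<^sub>2) N then 1 else 0)" for a
    by (simp add: normalized_coeff_def lookup_class_solution[OF fin])
  moreover have "Poly_Mapping.keys (class_solution \<Lambda> (\<alpha>\<^sub>1, \<alpha>\<^sub>2) N) \<subseteq> fiber \<Lambda> (\<alpha>\<^sub>1, \<alpha>\<^sub>2)"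
    by (auto simp: in_keys_iff lookup_class_solution[OF fin] sign_class_def split: if_splits)
  ultimately show ?thesis
    using N unfolding laurent_solutions_iff[OF assms(1)]
    by (auto simp: finite_minimal_negatives_def sign_class_def)
qed

text \<open>
  On an infinite class the normalized coefficient is constant and has finite support, so it is zero;
  on a class that is not minimal it vanishes by the combinatorial form of the system.
\<close>

lemma normalized_coeff_zero_unless_finite_minimal:
  assumes "finite \<Lambda>" and p: "p \<in> laurent_solutions \<Lambda> (of_int \<alpha>\<^sub>1) (of_int \<alpha>\<^sub>2)"
    and a: "a \<in> fiber \<Lambda> (\<alpha>\<^sub>1, \<alpha>\<^sub>2)"
    and "negatives a \<notin> finite_minimal_negatives \<Lambda> (\<alpha>\<^sub>1, \<alpha>\<^sub>2)"
  shows "normalized_coeff p a = 0"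
proof (cases "finite (sign_class \<Lambda> (\<alpha>\<^sub>1, \<alpha>\<^sub>2) (negatives a))")
  case True
  moreover have "sign_class \<Lambda> (\<alpha>\<^sub>1, \<alpha>\<^sub>2) (negatives a) \<noteq> {}"
    using a by (auto simp: sign_class_def)
  ultimately obtain a' where "a' \<in> fiber \<Lambda> (\<alpha>\<^sub>1, \<alpha>\<^sub>2)" "negatives a' \<subset> negatives a"
    using assms(4) by (auto simp: finite_minimal_negatives_def)
  then show ?thesis
    using normalized_coeff_compatible[OF assms(1) p a, of a'] by auto
next
  case False
  then obtain a' where "a' \<in> sign_class \<Lambda> (\<alpha>\<^sub>1, \<alpha>\<^sub>2) (negatives a)" "a' \<notin> Poly_Mapping.keys p"
    by (meson finite_keys finite_subset subsetI)
  then have "a' \<in> fiber \<Lambda> (\<alpha>\<^sub>1, \<alpha>\<^sub>2)" "negatives a' = negatives a" "normalized_coeff p a' = 0"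
    by (auto simp: sign_class_def normalized_coeff_def in_keys_iff)
  then show ?thesis
    using normalized_coeff_compatible[OF assms(1) p a, of a'] by simp
qed

text \<open>
  The class solutions have disjoint supports, which gives independence; a solution is the combination
  of them whose coefficient at a class is its constant normalized coefficient there.
\<close>

theorem laurent_solutions_basis:
  fixes \<alpha>\<^sub>1 \<alpha>\<^sub>2 :: int
  assumes "finite \<Lambda>"
  defines "M \<equiv> finite_minimal_negatives \<Lambda> (\<alpha>\<^sub>1, \<alpha>\<^sub>2)"
    and "L \<equiv> laurent_solutions \<Lambda> (of_int \<alpha>\<^sub>1) (of_int \<alpha>\<^sub>2)"
  shows "laurent.span (class_solution \<Lambda> (\<alpha>\<^sub>1, \<alpha>\<^sub>2) ` M) = L" and "laurent.dim L = card M"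
proof -
  let ?s = "class_solution \<Lambda> (\<alpha>\<^sub>1, \<alpha>\<^sub>2)"
  have finM: "finite M"
    using finite_finite_minimal_negatives[OF assms(1)] by (simp add: M_def)
  note comb = lookup_class_combination[OF assms(1), of M "(\<alpha>\<^sub>1, \<alpha>\<^sub>2)", OF meta_eq_to_obj_eq[OF M_def]]
  have rep: "\<exists>a. a \<in> fiber \<Lambda> (\<alpha>\<^sub>1, \<alpha>\<^sub>2) \<and> negatives a = N" if "N \<in> M" for N
    using that by (auto simp: M_def finite_minimal_negatives_def sign_class_def)
  show span: "laurent.span (?s ` M) = L"
  proof
    show "laurent.span (?s ` M) \<subseteq> L"
      using assms class_solution_is_solution
      by (intro laurent.span_minimal) (auto simp: subspace_laurent_solutions)
    show "L \<subseteq> laurent.span (?s ` M)"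
    proof
      fix p assume p: "p \<in> L"
      obtain r where r: "r N \<in> fiber \<Lambda> (\<alpha>\<^sub>1, \<alpha>\<^sub>2)" "negatives (r N) = N" if "N \<in> M" for N
        using rep by metis
      have "p = (\<Sum>N\<in>M. laurent_scale (normalized_coeff p (r N)) (?s N))"
      proof (rule poly_mapping_eqI, unfold comb)
        fix a
        show "Poly_Mapping.lookup p a = (if a \<in> fiber \<Lambda> (\<alpha>\<^sub>1, \<alpha>\<^sub>2) \<and> negatives a \<in> M
          then normalized_coeff p (r (negatives a)) * gamma_coeff a else 0)"
        proof (cases "a \<in> fiber \<Lambda> (\<alpha>\<^sub>1, \<alpha>\<^sub>2)")
          case aF: True
          have "normalized_coeff p a = normalized_coeff p (r (negatives a))" if "negatives a \<in> M"
            using normalized_coeff_compatible[OF assms(1) p[unfolded L_def] aF, of "r (negatives a)"]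
              r[OF that] by simp
          moreover have "normalized_coeff p a = 0" if "negatives a \<notin> M"
            using normalized_coeff_zero_unless_finite_minimal[OF assms(1) _ aF] p that
            by (simp add: L_def M_def)
          ultimately show ?thesis
            using aF by (simp add: lookup_normalized[of p])
        next
          case False
          then show ?thesis
            using p unfolding L_def laurent_solutions_iff[OF assms(1)] by (auto simp: in_keys_iff)
        qed
      qed
      also have "\<dots> \<in> laurent.span (?s ` M)"
        by (intro laurent.span_sum laurent.span_scale laurent.span_base) auto
      finally show "p \<in> laurent.span (?s ` M)" .
    qed
  qed
  have zero: "t N = 0" if eq: "(\<Sum>N\<in>M. laurent_scale (t N) (?s N)) = 0" and N: "N \<in> M" for t N
  proof -
    obtain a where a: "a \<in> fiber \<Lambda> (\<alpha>\<^sub>1, \<alpha>\<^sub>2)" "negatives a = N"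
      using rep[OF N] by blast
    have "Poly_Mapping.lookup (\<Sum>N\<in>M. laurent_scale (t N) (?s N)) a = t N * gamma_coeff a"
      using a N by (simp add: comb)
    with eq show "t N = 0"
      by simp
  qed
  have inj: "inj_on ?s M"
  proof (rule inj_onI)
    fix N N' assume NN': "N \<in> M" "N' \<in> M" "?s N = ?s N'"
    obtain a where a: "a \<in> fiber \<Lambda> (\<alpha>\<^sub>1, \<alpha>\<^sub>2)" "negatives a = N"
      using rep NN' by blast
    have "finite (sign_class \<Lambda> (\<alpha>\<^sub>1, \<alpha>\<^sub>2) N)" "finite (sign_class \<Lambda> (\<alpha>\<^sub>1, \<alpha>\<^sub>2) N')"
      using NN' by (auto simp: M_def finite_minimal_negatives_def)
    then show "N = N'"
      using a arg_cong[OF NN'(3), of "\<lambda>p. Poly_Mapping.lookup p a"]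
      by (auto simp: lookup_class_solution sign_class_def split: if_splits)
  qed
  have "laurent.independent (?s ` M)"
  proof (rule laurent.independent_if_scalars_zero)
    show "finite (?s ` M)"
      using finM by simp
    fix f x assume sum: "(\<Sum>x\<in>?s ` M. laurent_scale (f x) x) = 0" and x: "x \<in> ?s ` M"
    from sum have "(\<Sum>N\<in>M. laurent_scale (f (?s N)) (?s N)) = 0"
      by (simp add: sum.reindex[OF inj])
    from zero[OF this] x show "f x = 0"
      by auto
  qed
  then show "laurent.dim L = card M"
    using laurent.dim_span_eq_card_independent[of "?s ` M"] card_image[OF inj] by (simp add: span)
qed


section \<open>Finite minimal negative sets of a monomial curve\<close>

text \<open>
  Moving along \<open>v\<close> from a point with negative set \<open>N\<close> can only shrink the negative set, hence keeps
  it by minimality; a nonzero \<open>v\<close> would produce infinitely many points with negative set \<open>N\<close>.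
\<close>

lemma relation_trivial_if_finite_minimal:
  assumes "finite \<Lambda>" and N: "N \<in> finite_minimal_negatives \<Lambda> \<alpha>"
    and v: "mat_vec \<Lambda> v = 0" and neg: "\<And>j. j \<in> \<Lambda> \<Longrightarrow> v j < 0 \<Longrightarrow> j \<in> N" and "i \<in> \<Lambda>"
  shows "v i = 0"
proof (rule ccontr)
  assume "v i \<noteq> 0"
  obtain a where a: "a \<in> fiber \<Lambda> \<alpha>" "negatives a = N"
    using N by (auto simp: finite_minimal_negatives_def sign_class_def)
  define r where "r t = exponent_vec \<Lambda> (\<lambda>j. Poly_Mapping.lookup a j + int t * v j)" for t
  have r: "Poly_Mapping.lookup (r t) j
      = (if j \<in> \<Lambda> then Poly_Mapping.lookup a j + int t * v j else 0)" for t j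
    using assms(1) by (simp add: r_def lookup_exponent_vec)
  have "r t \<in> sign_class \<Lambda> \<alpha> N" for t
  proof -
    have fib: "r t \<in> fiber \<Lambda> \<alpha>"
      unfolding r_def using a v assms(1)
      by (intro exponent_vec_in_fiber) (auto simp: mat_vec_add mat_vec_scale_zero fiber_def)
    have "negatives (r t) \<subseteq> N"
    proof
      fix j assume "j \<in> negatives (r t)"
      then have "j \<in> \<Lambda>" and lt: "Poly_Mapping.lookup a j + int t * v j < 0"
        by (auto simp: negatives_def r split: if_splits)
      show "j \<in> N"
      proof (cases "v j < 0")
        case False
        then have "0 \<le> int t * v j"
          by simp
        with lt show ?thesis
          using a by (auto simp: negatives_def)
      qed (use neg \<open>j \<in> \<Lambda>\<close> in blast)
    qed
    with fib N show ?thesis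
      by (auto simp: finite_minimal_negatives_def sign_class_def)
  qed
  moreover have "inj r"
  proof (rule injI)
    fix s t assume "r s = r t"
    then have "Poly_Mapping.lookup (r s) i = Poly_Mapping.lookup (r t) i"
      by simp
    with \<open>i \<in> \<Lambda>\<close> \<open>v i \<noteq> 0\<close> show "s = t"
      by (simp add: r)
  qed
  ultimately have "infinite (sign_class \<Lambda> \<alpha> N)"
    by (metis finite_imageD finite_subset image_subsetI infinite_UNIV_nat)
  with N show False
    by (simp add: finite_minimal_negatives_def)
qed

lemma finite_minimal_negatives_curve:
  assumes "finite \<Lambda>" and ends: "0 \<in> \<Lambda>" "d \<in> \<Lambda>" and bound: "\<And>j. j \<in> \<Lambda> \<Longrightarrow> j \<le> d"
    and inner: "i \<in> \<Lambda>" "0 < i" "i < d"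
  shows "finite_minimal_negatives \<Lambda> \<alpha> \<subseteq> {{}, {0}, {d}}"
proof
  fix N assume N: "N \<in> finite_minimal_negatives \<Lambda> \<alpha>"
  \<comment> \<open>The relation \<open>(d - j) e\<^sub>0 - d e\<^sub>j + j e\<^sub>d\<close> among three columns.\<close>
  define v where "v j l = (if l = 0 then int d - int j else 0) + (if l = j then - int d else 0)
      + (if l = d then int j else 0)" for j l
  have rel: "mat_vec \<Lambda> (v j) = 0" if "j \<in> \<Lambda>" for j
    using assms that
    by (simp add: v_def mat_vec_def zero_prod_def sum.distrib distrib_left if_distrib[of "(*) _"]
        cong: if_cong)
  have "N \<subseteq> \<Lambda>"
    using N by (auto simp: finite_minimal_negatives_def sign_class_def dest: negatives_subset)
  moreover have "j \<notin> N" if j: "j \<in> \<Lambda>" "0 < j" "j < d" for j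
  proof
    assume "j \<in> N"
    then have "v j l < 0 \<Longrightarrow> l \<in> N" for l
      using j by (auto simp: v_def split: if_splits)
    then have "v j j = 0"
      using relation_trivial_if_finite_minimal[OF assms(1) N rel[OF j(1)] _ j(1)] by blast
    with j show False
      by (simp add: v_def)
  qed
  moreover have "0 \<notin> N \<or> d \<notin> N"
  proof (rule ccontr)
    assume "\<not> (0 \<notin> N \<or> d \<notin> N)"
    then have "- v i l < 0 \<Longrightarrow> l \<in> N" for l
      using inner by (auto simp: v_def split: if_splits)
    moreover have "mat_vec \<Lambda> (\<lambda>l. - v i l) = 0"
      using mat_vec_scale_zero[OF rel[OF inner(1)], of "- 1"] by simp
    ultimately have "- v i i = 0"
      using relation_trivial_if_finite_minimal[OF assms(1) N _ _ inner(1), of "\<lambda>l. - v i l"] by blast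
    with inner show False
      by (simp add: v_def)
  qed
  ultimately have "N \<subseteq> {0} \<or> N \<subseteq> {d}"
    using bound by (metis bot_nat_0.not_eq_extremum insert_iff nat_less_le subset_iff)
  then show "N \<in> {{}, {0}, {d}}"
    by (auto simp: subset_singleton_iff)
qed

lemma finite_bounded_exponents:
  assumes "finite \<Lambda>"
  shows "finite {a :: nat \<Rightarrow>\<^sub>0 int. Poly_Mapping.keys a \<subseteq> \<Lambda> \<and> (\<forall>j\<in>\<Lambda>. \<bar>Poly_Mapping.lookup a j\<bar> \<le> B)}"
    (is "finite ?A")
proof (rule finite_imageD)
  have "Poly_Mapping.lookup ` ?A
      \<subseteq> {f. \<forall>j. (j \<in> \<Lambda> \<longrightarrow> f j \<in> {-B..B}) \<and> (j \<notin> \<Lambda> \<longrightarrow> f j = 0)}"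
    by (auto simp: abs_le_iff in_keys_iff)
  then show "finite (Poly_Mapping.lookup ` ?A)"
    using finite_set_of_finite_funs[OF assms, of "{-B..B}" 0] by (rule finite_subset) simp
  show "inj_on Poly_Mapping.lookup ?A"
    by (simp add: inj_on_def)
qed

text \<open>
  An extreme column \<open>z\<close> is where an affine functional that is positive on the other columns
  vanishes.  The value of this functional bounds the sum of the other coordinates, and then the
  first row of the matrix bounds the coordinate at \<open>z\<close>.
\<close>

lemma finite_negatives_extreme:
  fixes s t :: int
  assumes "finite \<Lambda>" and z: "z \<in> \<Lambda>" "s + t * int z = 0"
    and pos: "\<And>j. j \<in> \<Lambda> \<Longrightarrow> j \<noteq> z \<Longrightarrow> 1 \<le> s + t * int j"
  shows "finite {a \<in> fiber \<Lambda> (\<alpha>\<^sub>1, \<alpha>\<^sub>2). negatives a \<subseteq> {z}}"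
proof (rule finite_subset)
  let ?B = "\<bar>\<alpha>\<^sub>1\<bar> + \<bar>s * \<alpha>\<^sub>1 + t * \<alpha>\<^sub>2\<bar>"
  show "{a \<in> fiber \<Lambda> (\<alpha>\<^sub>1, \<alpha>\<^sub>2). negatives a \<subseteq> {z}}
      \<subseteq> {a. Poly_Mapping.keys a \<subseteq> \<Lambda> \<and> (\<forall>j\<in>\<Lambda>. \<bar>Poly_Mapping.lookup a j\<bar> \<le> ?B)}"
  proof safe
    fix a j assume a: "a \<in> fiber \<Lambda> (\<alpha>\<^sub>1, \<alpha>\<^sub>2)" "negatives a \<subseteq> {z}" and j: "j \<in> \<Lambda>"
    let ?S = "\<Sum>l\<in>\<Lambda> - {z}. Poly_Mapping.lookup a l"
    have nonneg: "0 \<le> Poly_Mapping.lookup a l" if "l \<noteq> z" for l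
      using a(2) that by (force simp: negatives_def)
    have rows: "(\<Sum>l\<in>\<Lambda>. Poly_Mapping.lookup a l) = \<alpha>\<^sub>1"
      "(\<Sum>l\<in>\<Lambda>. int l * Poly_Mapping.lookup a l) = \<alpha>\<^sub>2"
      using a(1) by (auto simp: fiber_def mat_vec_def)
    have S0: "0 \<le> ?S"
      by (intro sum_nonneg) (use nonneg in auto)
    have "?S \<le> (\<Sum>l\<in>\<Lambda> - {z}. (s + t * int l) * Poly_Mapping.lookup a l)"
    proof (rule sum_mono)
      fix l assume "l \<in> \<Lambda> - {z}"
      then show "Poly_Mapping.lookup a l \<le> (s + t * int l) * Poly_Mapping.lookup a l"
        using mult_right_mono[OF pos[of l] nonneg[of l]] by auto
    qed
    also have "\<dots> = (\<Sum>l\<in>\<Lambda>. (s + t * int l) * Poly_Mapping.lookup a l)"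
      using assms(1) z by (simp add: sum.remove)
    also have "\<dots> = s * \<alpha>\<^sub>1 + t * \<alpha>\<^sub>2"
      by (simp add: distrib_right sum.distrib mult.assoc rows flip: sum_distrib_left)
    finally have S: "?S \<le> s * \<alpha>\<^sub>1 + t * \<alpha>\<^sub>2" .
    show "\<bar>Poly_Mapping.lookup a j\<bar> \<le> ?B"
    proof (cases "j = z")
      case True
      have "Poly_Mapping.lookup a z + ?S = \<alpha>\<^sub>1"
        using rows(1) assms(1) z(1) by (simp add: sum.remove)
      then show ?thesis
        unfolding True using S S0 by linarith
    next
      case False
      then have "Poly_Mapping.lookup a j \<le> ?S"
        using j assms(1) nonneg by (intro member_le_sum) auto
      then show ?thesis
        using S nonneg[OF False] by linarith
    qed
  qed (auto simp: fiber_def)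
qed (rule finite_bounded_exponents[OF assms(1)])

lemma I_set_iff:
  assumes "finite \<Lambda>"
  shows "\<alpha> \<in> I_set \<Lambda> \<longleftrightarrow> sign_class \<Lambda> \<alpha> {} \<noteq> {}"
proof
  assume "\<alpha> \<in> I_set \<Lambda>"
  then obtain u where "\<alpha> = mat_vec \<Lambda> (\<lambda>j. int (u j))"
    by (auto simp: I_set_def nat_combs_def)
  then have "exponent_vec \<Lambda> (\<lambda>j. int (u j)) \<in> sign_class \<Lambda> \<alpha> {}"
    using assms by (auto simp: sign_class_def exponent_vec_in_fiber negatives_def
        lookup_exponent_vec not_less)
  then show "sign_class \<Lambda> \<alpha> {} \<noteq> {}"
    by blast
next
  assume "sign_class \<Lambda> \<alpha> {} \<noteq> {}"
  then obtain a where a: "a \<in> fiber \<Lambda> \<alpha>" "negatives a = {}"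
    by (auto simp: sign_class_def)
  then have "\<alpha> = mat_vec \<Lambda> (\<lambda>j. int (nat (Poly_Mapping.lookup a j)))"
    by (auto simp: fiber_def negatives_def not_less)
  then show "\<alpha> \<in> I_set \<Lambda>"
    by (auto simp: I_set_def nat_combs_def intro!: exI[of _ "\<lambda>j. nat (Poly_Mapping.lookup a j)"])
qed

text \<open>
  With \<open>z = 0\<close> and \<open>z = d\<close> the set on the left is \<open>E\<^sub>0\<close> and \<open>E\<^sub>d\<close>, respectively.  A point
  outside \<open>I\<close> requires \<open>n > 0\<close>, so the coordinate at \<open>z\<close> is truly negative.
\<close>

lemma column_cone_minus_I_iff:
  assumes "finite \<Lambda>" and z: "z \<in> \<Lambda>"
  shows "\<alpha> \<in> {c - (int n, int n * int z) | c n. c \<in> nat_combs (\<Lambda> - {z})} - I_set \<Lambda> \<longleftrightarrow>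
    sign_class \<Lambda> \<alpha> {z} \<noteq> {} \<and> sign_class \<Lambda> \<alpha> {} = {}"
proof -
  have "sign_class \<Lambda> \<alpha> {z} \<noteq> {}"
    if mem: "\<alpha> \<in> {c - (int n, int n * int z) | c n. c \<in> nat_combs (\<Lambda> - {z})}"
      and empty: "sign_class \<Lambda> \<alpha> {} = {}"
  proof -
    from mem obtain u n where \<alpha>: "\<alpha> = mat_vec (\<Lambda> - {z}) (\<lambda>j. int (u j)) - (int n, int n * int z)"
      unfolding nat_combs_def by blast
    define f where "f j = (if j = z then - int n else int (u j))" for j
    have "mat_vec (\<Lambda> - {z}) f = mat_vec (\<Lambda> - {z}) (\<lambda>j. int (u j))"
      by (rule mat_vec_cong) (simp add: f_def)
    then have "mat_vec \<Lambda> f = \<alpha>"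
      by (simp add: mat_vec_remove[OF assms] \<alpha>) (simp add: f_def prod_eq_iff)
    then have fib: "exponent_vec \<Lambda> f \<in> fiber \<Lambda> \<alpha>"
      by (rule exponent_vec_in_fiber[OF assms(1)])
    moreover have "negatives (exponent_vec \<Lambda> f) \<subseteq> {z}"
      using assms(1) by (auto simp: negatives_def lookup_exponent_vec f_def split: if_splits)
    ultimately show ?thesis
      using empty by (auto simp: sign_class_def subset_singleton_iff)
  qed
  moreover have "\<alpha> \<in> {c - (int n, int n * int z) | c n. c \<in> nat_combs (\<Lambda> - {z})}"
    if "sign_class \<Lambda> \<alpha> {z} \<noteq> {}"
  proof -
    from that obtain a where a: "a \<in> fiber \<Lambda> \<alpha>" "negatives a = {z}"
      by (auto simp: sign_class_def)
    let ?u = "\<lambda>j. nat (Poly_Mapping.lookup a j)" and ?n = "nat (- Poly_Mapping.lookup a z)"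
    have nonneg: "0 \<le> Poly_Mapping.lookup a j" if "j \<noteq> z" for j
      using a(2) that by (force simp: negatives_def)
    have neg: "Poly_Mapping.lookup a z < 0"
      using a(2) by (auto simp: negatives_def)
    have "mat_vec (\<Lambda> - {z}) (\<lambda>j. int (?u j)) = mat_vec (\<Lambda> - {z}) (Poly_Mapping.lookup a)"
      by (rule mat_vec_cong) (use nonneg in auto)
    moreover have "\<alpha> = mat_vec \<Lambda> (Poly_Mapping.lookup a)"
      using a(1) by (simp add: fiber_def)
    ultimately have "\<alpha> = mat_vec (\<Lambda> - {z}) (\<lambda>j. int (?u j)) - (int ?n, int ?n * int z)"
      using neg by (simp add: mat_vec_remove[OF assms] prod_eq_iff)
    moreover have "mat_vec (\<Lambda> - {z}) (\<lambda>j. int (?u j)) \<in> nat_combs (\<Lambda> - {z})"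
      unfolding nat_combs_def by (rule CollectI, rule exI[of _ ?u]) simp
    ultimately show ?thesis
      by blast
  qed
  ultimately show ?thesis
    using I_set_iff[OF assms(1), of \<alpha>] by blast
qed

theorem corollary1p5:
  fixes m d :: nat and k :: "nat \<Rightarrow> nat" and \<Lambda> :: "nat set"
    and \<alpha>\<^sub>1 \<alpha>\<^sub>2 :: int and L :: "laurent set"
  assumes "1 \<le> m" and "0 < k 1" and "strict_mono_on {1..m} k" and "k m < d"
    and "Gcd (k ` {1..m} \<union> {d}) = 1"
  defines "\<Lambda> \<equiv> index_set m k d"
  defines "L \<equiv> laurent_solutions \<Lambda> (of_int \<alpha>\<^sub>1) (of_int \<alpha>\<^sub>2)"
  shows "(\<exists>B. finite B \<and> laurent.span B = L) \<and> laurent.dim L \<le> 2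
    \<and> (laurent.dim L \<ge> 1 \<longleftrightarrow> (\<alpha>\<^sub>1, \<alpha>\<^sub>2) \<in> I_set \<Lambda> \<union> E0_set \<Lambda> \<union> Ed_set \<Lambda> d)
    \<and> (laurent.dim L = 2 \<longleftrightarrow> (\<alpha>\<^sub>1, \<alpha>\<^sub>2) \<in> E_set \<Lambda> d)"
proof -
  let ?\<alpha> = "(\<alpha>\<^sub>1, \<alpha>\<^sub>2)"
  let ?M = "finite_minimal_negatives \<Lambda> ?\<alpha>"
  have fin: "finite \<Lambda>" and ends: "0 \<in> \<Lambda>" "d \<in> \<Lambda>" and inner: "k 1 \<in> \<Lambda>"
    using assms(1) by (auto simp: \<Lambda>_def index_set_def)
  have k_bound: "k i \<le> k m" if "i \<in> {1..m}" for i
    using strict_mono_on_leD[OF assms(3), of i m] that by auto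
  then have bound: "j \<le> d" if "j \<in> \<Lambda>" for j
    using that assms(4) by (fastforce simp: \<Lambda>_def index_set_def)
  have k1: "k 1 < d"
    using k_bound[of 1] assms(1,4) by simp
  then have "0 < d"
    by simp
  have M: "?M \<subseteq> {{}, {0}, {d}}"
    using finite_minimal_negatives_curve[OF fin ends bound inner assms(2) k1] by simp
  have fin0: "finite {a \<in> fiber \<Lambda> ?\<alpha>. negatives a \<subseteq> {0}}"
    using fin ends by (intro finite_negatives_extreme[where s = 0 and t = 1]) auto
  have find: "finite {a \<in> fiber \<Lambda> ?\<alpha>. negatives a \<subseteq> {d}}"
    using fin ends bound
    by (intro finite_negatives_extreme[where s = "int d" and t = "- 1"])
      (auto dest!: bound simp: order.order_iff_strict)
  have "{} \<in> ?M \<longleftrightarrow> ?\<alpha> \<in> I_set \<Lambda>"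
    using finite_subset[OF _ fin0, of "sign_class \<Lambda> ?\<alpha> {}"]
    by (auto simp: I_set_iff[OF fin] finite_minimal_negatives_def sign_class_def)
  moreover have singleton: "{z} \<in> ?M \<longleftrightarrow> sign_class \<Lambda> ?\<alpha> {z} \<noteq> {} \<and> sign_class \<Lambda> ?\<alpha> {} = {}"
    if "finite {a \<in> fiber \<Lambda> ?\<alpha>. negatives a \<subseteq> {z}}" for z
    using finite_subset[OF _ that, of "sign_class \<Lambda> ?\<alpha> {z}"]
    by (auto simp: finite_minimal_negatives_def sign_class_def subset_singleton_iff)
  have "{0} \<in> ?M \<longleftrightarrow> ?\<alpha> \<in> E0_set \<Lambda>"
    using column_cone_minus_I_iff[OF fin ends(1), of ?\<alpha>] singleton[OF fin0]
    by (simp add: E0_set_def F0_set_def)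
  moreover have "{d} \<in> ?M \<longleftrightarrow> ?\<alpha> \<in> Ed_set \<Lambda> d"
    using column_cone_minus_I_iff[OF fin ends(2), of ?\<alpha>] singleton[OF find]
    by (simp add: Ed_set_def Fd_set_def)
  ultimately have "?M = (if ?\<alpha> \<in> I_set \<Lambda> then {{}} else {})
      \<union> (if ?\<alpha> \<in> E0_set \<Lambda> then {{0}} else {}) \<union> (if ?\<alpha> \<in> Ed_set \<Lambda> d then {{d}} else {})"
    using M by (auto split: if_splits)
  moreover have "?\<alpha> \<notin> E0_set \<Lambda> \<and> ?\<alpha> \<notin> Ed_set \<Lambda> d" if "?\<alpha> \<in> I_set \<Lambda>"
    using that by (simp add: E0_set_def Ed_set_def)
  moreover have "laurent.dim L = card ?M"
    unfolding L_def by (rule laurent_solutions_basis(2)[OF fin])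
  moreover have "\<exists>B. finite B \<and> laurent.span B = L"
    unfolding L_def using laurent_solutions_basis(1)[OF fin] finite_finite_minimal_negatives[OF fin]
    by (metis finite_imageI)
  ultimately show ?thesis
    using \<open>0 < d\<close> by (auto simp: E_set_def)
qed

end
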